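(* A loxodrome $\alpha$ on a rotational surface $R$ in $\mathbb{E}^3$ with a positive constant Gaussian curvature $K_0$ can be parametrized by $$\alpha(t)=\begin{pmatrix}\big(A\cos(a\sqrt{K_0}\,t+a_0)+B\sin(a\sqrt{K_0}\,t+a_0)\big)\cos\theta(t)\\ \big(A\cos(a\sqrt{K_0}\,t+a_0)+B\sin(a\sqrt{K_0}\,t+a_0)\big)\sin\theta(t)\\ \pm\displaystyle\int_0^{at+c}\sqrt{1-K_0\big(A\sin(\sqrt{K_0}\xi)-B\cos(\sqrt{K_0}\xi)\big)^2}\,d\xi\end{pmatrix},$$ where the function $\theta(t)$ is given by one of the following: (i) $\displaystyle\theta(t)=\frac{\varepsilon\tan\psi}{B\sqrt{K_0}}\ln\left|\tan\left(\tfrac12(a\sqrt{K_0}\,t+a_0)\right)\right|+\theta_0$ for $A=0$ and $B\neq0$; (ii) $\displaystyle\theta(t)=\frac{2\varepsilon\tan\psi}{\sqrt{K_0(A^2+B^2)}}\,\operatorname{arctanh}\left(\frac{1}{\sqrt{A^2+B^2}}\left(A\tan\left(\tfrac12(a\sqrt{K_0}\,t+a_0)\right)-B\right)\right)+\theta_0$ for $A\neq0$; and $A,B,a_0,\theta_0$, $a=\cos\psi$ are constants.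
   Context: A rotational surface $R$ is given by an immersion $\Phi(s,\theta)=(f(s)\cos\theta,f(s)\sin\theta,g(s))$ with $f'^2+g'^2=1$; its Gaussian curvature is $K=-f''/f$. Meridians are the curves $s\mapsto\Phi(s,\theta)$ with $\theta$ constant. A loxodrome on $R$ is a curve $\alpha(t)=\Phi(s(t),\theta(t))$, parametrized by arc length $t$, which meets the meridians at a constant angle $\psi\in[0,\pi]$. Here $s(t)=at+c$ with $c$ a constant, $f(s)=A\cos(\sqrt{K_0}s)+B\sin(\sqrt{K_0}s)$ (so $a_0$ arises as $c\sqrt{K_0}$), and $\varepsilon=\pm1$.
   Formalization: The third coordinate carries an additive constant (the formula fails for surfaces translated along the axis), meridian arc length starts at a base point chosen so that the arctanh is defined, and ψ=π/2 is excluded because tan ψ is undefined there. *)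

theory Defs
  imports "HOL-Analysis.Analysis"
begin

text \<open>A parametrized surface is a map \<^term>\<open>X :: real \<Rightarrow> real \<Rightarrow> real^3\<close>.\<close>

definition partial1 :: "(real \<Rightarrow> real \<Rightarrow> real^3) \<Rightarrow> real \<Rightarrow> real \<Rightarrow> real^3" where
  "partial1 X u v = vector_derivative (\<lambda>x. X x v) (at u)"

definition partial2 :: "(real \<Rightarrow> real \<Rightarrow> real^3) \<Rightarrow> real \<Rightarrow> real \<Rightarrow> real^3" where
  "partial2 X u v = vector_derivative (\<lambda>y. X u y) (at v)"

definition unit_normal :: "(real \<Rightarrow> real \<Rightarrow> real^3) \<Rightarrow> real \<Rightarrow> real \<Rightarrow> real^3" where
  "unit_normal X u v =
     (let n = cross3 (partial1 X u v) (partial2 X u v) in n /\<^sub>R norm n)"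

text \<open>Quotient of the determinants of the second and the first fundamental form.\<close>

definition gaussian_curvature :: "(real \<Rightarrow> real \<Rightarrow> real^3) \<Rightarrow> real \<Rightarrow> real \<Rightarrow> real" where
  "gaussian_curvature X u v =
     (let E = partial1 X u v \<bullet> partial1 X u v;
          F = partial1 X u v \<bullet> partial2 X u v;
          G = partial2 X u v \<bullet> partial2 X u v;
          n = unit_normal X u v;
          L = partial1 (partial1 X) u v \<bullet> n;
          M = partial2 (partial1 X) u v \<bullet> n;
          N = partial2 (partial2 X) u v \<bullet> n
      in (L * N - M\<^sup>2) / (E * G - F\<^sup>2))"

definition immersion_on :: "(real \<times> real) set \<Rightarrow> (real \<Rightarrow> real \<Rightarrow> real^3) \<Rightarrow> bool" where
  "immersion_on S X \<longleftrightarrow>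
     (\<forall>p\<in>S. \<exists>D. ((\<lambda>(u, v). X u v) has_derivative D) (at p) \<and> inj D)"

definition rot :: "(real \<Rightarrow> real) \<Rightarrow> (real \<Rightarrow> real) \<Rightarrow> real \<Rightarrow> real \<Rightarrow> real^3" where
  "rot f g s \<theta> = vector [f s * cos \<theta>, f s * sin \<theta>, g s]"

definition twice_differentiable_on :: "(real \<Rightarrow> real) \<Rightarrow> real set \<Rightarrow> bool" where
  "twice_differentiable_on f I \<longleftrightarrow> f differentiable_on I \<and> deriv f differentiable_on I"

definition rotational_surface :: "real set \<Rightarrow> (real \<Rightarrow> real) \<Rightarrow> (real \<Rightarrow> real) \<Rightarrow> bool" where
  "rotational_surface I f g \<longleftrightarrow>
     open I \<and> is_interval I \<and> I \<noteq> {} \<and>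
     twice_differentiable_on f I \<and> twice_differentiable_on g I \<and>
     (\<forall>s\<in>I. (deriv f s)\<^sup>2 + (deriv g s)\<^sup>2 = 1) \<and>
     immersion_on {(s, \<theta>). s \<in> I} (rot f g)"

lemma vec3_hvd:
  assumes "(p has_real_derivative p') (at x)" "(q has_real_derivative q') (at x)"
    "(r has_real_derivative r') (at x)"
  shows "((\<lambda>x. vector [p x, q x, r x] :: real^3) has_vector_derivative vector [p', q', r']) (at x)"
proof -
  have eq: "(vector [a, b, c] :: real^3) = a *\<^sub>R axis 1 1 + b *\<^sub>R axis 2 1 + c *\<^sub>R axis 3 1" for a b c
    by (simp add: vec_eq_iff forall_3 axis_def)
  show ?thesis unfolding eq
    by (rule derivative_eq_intros assms | simp)+
qed

lemma rotational_surface_nonzero: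
  assumes S: "rotational_surface I f g" and u: "u \<in> I"
  shows "f u \<noteq> 0"
proof
  assume f0: "f u = 0"
  have "immersion_on {(s, \<theta>). s \<in> I} (rot f g)"
    using S by (simp add: rotational_surface_def)
  then obtain D where D: "((\<lambda>(x, y). rot f g x y) has_derivative D) (at (u, 0))" "inj D"
    using u unfolding immersion_on_def by blast
  have "((\<lambda>y. (u, y)) has_derivative (\<lambda>h. (0, h))) (at (0::real))"
    by (auto intro!: derivative_eq_intros)
  from has_derivative_compose[OF this D(1)]
  have "((\<lambda>y. rot f g u y) has_derivative (\<lambda>h. D (0, h))) (at 0)"
    by simp
  moreover have "((\<lambda>y. rot f g u y) has_derivative (\<lambda>h. 0)) (at 0)"
    by (simp add: rot_def f0)
  ultimately have "(\<lambda>h. D (0, h)) = (\<lambda>h. 0)" by (rule has_derivative_unique)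
  then have "D (0, 1) = D (0, 0)" by metis
  then show False using D(2) by (auto dest: injD)
qed

lemma gaussian_curvature_rot:
  assumes S: "rotational_surface I f g" and u: "u \<in> I"
  shows "gaussian_curvature (rot f g) u v = - deriv (deriv f) u / f u"
proof -
  have f: "f u \<noteq> 0" using rotational_surface_nonzero[OF S u] .
  have I: "open I" using S by (simp add: rotational_surface_def)
  have D: "(h has_real_derivative deriv h x) (at x)" if "h differentiable_on I" "x \<in> I" for h :: "real \<Rightarrow> real" and x
    using that I by (metis DERIV_deriv_iff_real_differentiable at_within_open differentiable_on_def)
  have td: "f differentiable_on I" "deriv f differentiable_on I" "g differentiable_on I" "deriv g differentiable_on I"
    using S by (auto simp: rotational_surface_def twice_differentiable_on_def)
  note d = D[OF td(1)] D[OF td(2)] D[OF td(3)] D[OF td(4)]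
  have p1: "partial1 (rot f g) x y = vector [deriv f x * cos y, deriv f x * sin y, deriv g x]" if "x \<in> I" for x y
    unfolding partial1_def rot_def
    by (rule vector_derivative_at, rule vec3_hvd) (auto intro!: derivative_eq_intros d that)
  have p2: "partial2 (rot f g) x y = vector [- f x * sin y, f x * cos y, 0]" for x y
    unfolding partial2_def rot_def
    by (rule vector_derivative_at, rule vec3_hvd) (auto intro!: derivative_eq_intros)
  have p22: "partial2 (partial2 (rot f g)) u v = vector [- f u * cos v, - f u * sin v, 0]"
    unfolding partial2_def[of "partial2 _"] p2
    by (rule vector_derivative_at, rule vec3_hvd) (auto intro!: derivative_eq_intros)
  have p21: "partial2 (partial1 (rot f g)) u v = vector [- deriv f u * sin v, deriv f u * cos v, 0]"
    unfolding partial2_def p1[OF u]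
    by (rule vector_derivative_at, rule vec3_hvd) (auto intro!: derivative_eq_intros)
  have "((\<lambda>x. vector [deriv f x * cos v, deriv f x * sin v, deriv g x] :: real^3) has_vector_derivative
      vector [deriv (deriv f) u * cos v, deriv (deriv f) u * sin v, deriv (deriv g) u]) (at u)"
    by (rule vec3_hvd) (auto intro!: derivative_eq_intros d u)
  then have "((\<lambda>x. partial1 (rot f g) x v) has_vector_derivative
      vector [deriv (deriv f) u * cos v, deriv (deriv f) u * sin v, deriv (deriv g) u]) (at u)"
    by (rule has_vector_derivative_transform_within_open[OF _ I u]) (simp add: p1)
  then have p11: "partial1 (partial1 (rot f g)) u v =
      vector [deriv (deriv f) u * cos v, deriv (deriv f) u * sin v, deriv (deriv g) u]"
    unfolding partial1_def[of "partial1 _"] by (rule vector_derivative_at)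
  have unit: "(deriv f x)\<^sup>2 + (deriv g x)\<^sup>2 = 1" if "x \<in> I" for x
    using S that by (simp add: rotational_surface_def)
  have "((\<lambda>x. (deriv f x)\<^sup>2 + (deriv g x)\<^sup>2) has_real_derivative
      2 * deriv f u * deriv (deriv f) u + 2 * deriv g u * deriv (deriv g) u) (at u)"
    by (auto intro!: derivative_eq_intros d u)
  moreover have "((\<lambda>x. (deriv f x)\<^sup>2 + (deriv g x)\<^sup>2) has_real_derivative 0) (at u)"
    by (rule has_field_derivative_transform_within_open[OF DERIV_const[of 1] I u]) (simp add: unit)
  ultimately have "2 * deriv f u * deriv (deriv f) u + 2 * deriv g u * deriv (deriv g) u = 0"
    using DERIV_unique by blast
  then have gg: "deriv g u * deriv (deriv g) u = - deriv f u * deriv (deriv f) u" by (simp add: algebra_simps)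
  define F F' F'' G' G'' c s where "F = f u" "F' = deriv f u" "F'' = deriv (deriv f) u"
    "G' = deriv g u" "G'' = deriv (deriv g) u" "c = cos v" "s = sin v"
  note defs = this[symmetric]
  have cs: "c\<^sup>2 + s\<^sup>2 = 1" by (simp add: F_F'_F''_G'_G''_c_s_def)
  have un: "F'\<^sup>2 + G'\<^sup>2 = 1" using unit[OF u] by (simp add: defs)
  have gg: "G' * G'' = - F' * F''" using gg by (simp add: defs)
  have F0: "F \<noteq> 0" using f by (simp add: defs)
  define n where "n = cross3 (partial1 (rot f g) u v) (partial2 (rot f g) u v)"
  have n: "n = vector [- (F * G' * c), - (F * G' * s), F * F']"
    unfolding n_def p1[OF u] p2 cross3_def defs
    using cs by (simp add: vec_eq_iff forall_3 algebra_simps) algebra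
  have nn: "norm n ^ 2 = F\<^sup>2"
    unfolding power2_norm_eq_inner n using cs un by (simp add: inner_vec_def sum_3) algebra
  have E: "partial1 (rot f g) u v \<bullet> partial1 (rot f g) u v = 1"
    unfolding p1[OF u] defs using cs un by (simp add: inner_vec_def sum_3) algebra
  have Fm: "partial1 (rot f g) u v \<bullet> partial2 (rot f g) u v = 0"
    unfolding p1[OF u] p2 defs by (simp add: inner_vec_def sum_3)
  have G: "partial2 (rot f g) u v \<bullet> partial2 (rot f g) u v = F\<^sup>2"
    unfolding p2 defs using cs by (simp add: inner_vec_def sum_3) algebra
  have M: "partial2 (partial1 (rot f g)) u v \<bullet> n = 0"
    unfolding p21 n defs by (simp add: inner_vec_def sum_3)
  have L: "partial1 (partial1 (rot f g)) u v \<bullet> n = F * (F' * G'' - G' * F'')"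
    unfolding p11 n defs using cs by (simp add: inner_vec_def sum_3) algebra
  have N: "partial2 (partial2 (rot f g)) u v \<bullet> n = F * F * G'"
    unfolding p22 n defs using cs by (simp add: inner_vec_def sum_3) algebra
  have key: "(F' * G'' - G' * F'') * G' = - F''" using un gg by algebra
  have "gaussian_curvature (rot f g) u v
      = (F * (F' * G'' - G' * F'') * (F * F * G') / (norm n ^ 2)) / F\<^sup>2"
    by (simp add: gaussian_curvature_def Let_def unit_normal_def n_def[symmetric] E Fm G L M N power2_eq_square divide_simps)
  also have "\<dots> = F * ((F' * G'' - G' * F'') * G') / F\<^sup>2"
    unfolding nn using F0 by (simp add: divide_simps power2_eq_square)
  also have "\<dots> = - F'' / F" unfolding key using F0 by (simp add: power2_eq_square)
  finally show ?thesis by (simp add: F_F'_F''_G'_G''_c_s_def)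
qed

definition angle_between :: "real^3 \<Rightarrow> real^3 \<Rightarrow> real" where
  "angle_between x y = arccos ((x \<bullet> y) / (norm x * norm y))"

text \<open>The meridian through the point with parameters \<^term>\<open>s t\<close>, \<^term>\<open>\<theta> t\<close> is oriented by
  increasing \<^term>\<open>s\<close>; its tangent vector is the first partial derivative of the surface.\<close>

definition loxodrome ::
  "real set \<Rightarrow> (real \<Rightarrow> real) \<Rightarrow> (real \<Rightarrow> real) \<Rightarrow> real \<Rightarrow>
   real set \<Rightarrow> (real \<Rightarrow> real) \<Rightarrow> (real \<Rightarrow> real) \<Rightarrow> (real \<Rightarrow> real^3) \<Rightarrow> bool" where
  "loxodrome I f g \<psi> J s \<theta> \<alpha> \<longleftrightarrow>
     open J \<and> is_interval J \<and> J \<noteq> {} \<and>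
     s differentiable_on J \<and> \<theta> differentiable_on J \<and> s ` J \<subseteq> I \<and>
     (\<forall>t\<in>J. \<alpha> t = rot f g (s t) (\<theta> t) \<and>
            norm (vector_derivative \<alpha> (at t)) = 1 \<and>
            angle_between (vector_derivative \<alpha> (at t)) (partial1 (rot f g) (s t) (\<theta> t)) = \<psi>)"

text \<open>The profile radius written as a cosine-sine combination, with arc length along the
  meridians measured from \<^term>\<open>s\<^sub>0\<close>.  The second condition says that the argument of the inverse
  hyperbolic tangent occurring for \<^term>\<open>A \<noteq> 0\<close> is defined and lies in the open interval from -1
  to 1: with \<^term>\<open>x = sqrt K\<^sub>0 * (s - s\<^sub>0)\<close> and \<^term>\<open>w = tan (x / 2)\<close> one has
  \<^term>\<open>A * f s * (1 + w\<^sup>2) = A\<^sup>2 + B\<^sup>2 - (A * w - B)\<^sup>2\<close>, while \<^term>\<open>f s = - A\<close> at the poles of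
  \<^term>\<open>tan (x / 2)\<close>.  Replacing \<^term>\<open>s\<^sub>0\<close>, \<^term>\<open>A\<close>, \<^term>\<open>B\<close> by
  \<^term>\<open>s\<^sub>0 - pi / sqrt K\<^sub>0\<close>, \<^term>\<open>- A\<close>, \<^term>\<open>- B\<close> changes the sign of \<^term>\<open>A * f s\<close>.\<close>

definition trig_profile ::
  "real set \<Rightarrow> (real \<Rightarrow> real) \<Rightarrow> real \<Rightarrow> real \<Rightarrow> real \<Rightarrow> real \<Rightarrow> bool" where
  "trig_profile I f K\<^sub>0 s\<^sub>0 A B \<longleftrightarrow>
     (\<forall>s\<in>I. f s = A * cos (sqrt K\<^sub>0 * (s - s\<^sub>0)) + B * sin (sqrt K\<^sub>0 * (s - s\<^sub>0))) \<and>
     (A \<noteq> 0 \<longrightarrow> (\<forall>s\<in>I. A * f s > 0))"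

end

theory Submission
  imports Defs
begin

text \<open>Since \<open>f'' = - K\<^sub>0 f\<close> and \<open>f\<close> has no zeros, the profile radius is a cosine-sine combination of
  constant sign.  Unit speed and constant angle give \<open>s' = cos \<psi>\<close> and \<open>f\<^sup>2 \<theta>'\<^sup>2 = sin\<^sup>2 \<psi>\<close>, and the
  stated expressions for \<open>\<theta>\<close> are antiderivatives of \<open>\<plusminus> sin \<psi> / f\<close>.  The signs of \<open>\<theta>'\<close> and of
  \<open>g' = \<plusminus> sqrt (1 - f'\<^sup>2)\<close> cannot change, because nonvanishing derivatives have constant sign; \<open>g'\<close>
  has no zeros because \<open>f' f'' + g' g'' = 0\<close> whereas \<open>f'' \<noteq> 0\<close>.\<close>

section \<open>Calculus on real intervals: Darboux property, antiderivatives, integrals\<close>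

text \<open>Darboux's theorem for the value zero. \<open>F'\<close> is not assumed continuous;
  instead the minimum of \<open>F\<close> over \<open>{a..b}\<close> is attained, the signs of
  \<open>F'\<close> at the two ends keep it away from them, and an interior minimum is a critical
  point.\<close>

lemma deriv_zero_between:
  fixes F F' :: "real \<Rightarrow> real"
  assumes ab: "a < b" and F: "\<And>x. x \<in> {a..b} \<Longrightarrow> (F has_real_derivative F' x) (at x)"
    and signs: "F' a < 0" "F' b > 0"
  shows "\<exists>c\<in>{a..b}. F' c = 0"
proof -
  have "continuous_on {a..b} F"
    using F by (meson DERIV_isCont continuous_at_imp_continuous_on)
  then obtain c where c: "c \<in> {a..b}" and min: "\<And>x. x \<in> {a..b} \<Longrightarrow> F c \<le> F x"
    using continuous_attains_inf[of "{a..b}" F] ab by auto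
  have "c \<noteq> a"
  proof
    assume "c = a"
    obtain d where d: "d > 0" "\<And>h. 0 < h \<Longrightarrow> h < d \<Longrightarrow> F (a + h) < F a"
      using DERIV_neg_dec_right[OF F signs(1)] ab by force
    \<comment> \<open>The increment is smaller than \<open>d\<close> and at most
      \<open>b - a\<close>, so the smaller value of \<open>F\<close> is taken inside
      \<open>{a..b}\<close>.\<close>
    have "F (a + min (d / 2) (b - a)) < F a" using d ab by (intro d(2)) auto
    moreover have "a + min (d / 2) (b - a) \<in> {a..b}" using d ab by auto
    ultimately show False using min \<open>c = a\<close> by fastforce
  qed
  moreover have "c \<noteq> b"
  proof
    assume "c = b"
    obtain d where d: "d > 0" "\<And>h. 0 < h \<Longrightarrow> h < d \<Longrightarrow> F (b - h) < F b"
      using DERIV_pos_inc_left[OF F signs(2)] ab by force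
    have "F (b - min (d / 2) (b - a)) < F b" using d ab by (intro d(2)) auto
    moreover have "b - min (d / 2) (b - a) \<in> {a..b}" using d ab by auto
    ultimately show False using min \<open>c = b\<close> by fastforce
  qed
  ultimately have "0 < min (c - a) (b - c)" using c by auto
  moreover have "\<forall>y. \<bar>c - y\<bar> < min (c - a) (b - c) \<longrightarrow> F c \<le> F y"
    using min by (auto simp: abs_less_iff)
  ultimately have "F' c = 0" by (rule DERIV_local_min[OF F[OF c]])
  with c show ?thesis by blast
qed

text \<open>By Darboux, two opposite signs would force a zero of \<open>F'\<close>. The sign is
  given as a factor \<open>\<sigma>\<close> because such factors later multiply to give the sign of
  the angle formula. No continuity of \<open>F'\<close> enters, so this applies to
  \<open>deriv \<theta>\<close> and \<open>deriv (deriv f)\<close>, which are only known to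
  exist.\<close>

lemma nonzero_deriv_constant_sign:
  fixes F F' :: "real \<Rightarrow> real"
  assumes S: "is_interval S" and F: "\<And>x. x \<in> S \<Longrightarrow> (F has_real_derivative F' x) (at x)"
    and nz: "\<And>x. x \<in> S \<Longrightarrow> F' x \<noteq> 0"
  shows "\<exists>\<sigma>\<in>{1, -1}. \<forall>x\<in>S. \<sigma> * F' x > 0"
proof -
  have sub: "x \<in> S" if "a \<in> S" "b \<in> S" "x \<in> {a..b}" for a b x
    using mem_is_interval_1_I[OF S that(1,2)] that(3) by simp
  have False if a: "a \<in> S" "F' a < 0" and b: "b \<in> S" "F' b > 0" for a b
  proof (cases "a < b")
    case True
    have "\<exists>c\<in>{a..b}. F' c = 0"
      using True F[OF sub[OF a(1) b(1)]] a(2) b(2) by (rule deriv_zero_between)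
    then show False using nz sub[OF a(1) b(1)] by blast
  next
    case False
    then have "b < a" using a b by (cases "a = b") auto
    \<comment> \<open>When the positive value lies to the left, Darboux is applied to
      \<open>- F\<close>.\<close>
    have F_minus: "((\<lambda>x. - F x) has_real_derivative - F' x) (at x)" if "x \<in> S" for x
      using F[OF that] by (rule DERIV_minus)
    have "\<exists>c\<in>{b..a}. - F' c = 0"
    proof (rule deriv_zero_between)
      show "((\<lambda>x. - F x) has_real_derivative - F' x) (at x)" if "x \<in> {b..a}" for x
        using F_minus[OF sub[OF b(1) a(1) that]] .
    qed (use \<open>b < a\<close> a b in simp_all)
    then show False using nz sub[OF b(1) a(1)] by force
  qed
  then have "(\<forall>x\<in>S. F' x > 0) \<or> (\<forall>x\<in>S. F' x < 0)"
    using nz by (meson linorder_neqE_linordered_idom)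
  then show ?thesis by auto
qed

lemma equal_derivs_differ_by_constant:
  fixes F G D :: "real \<Rightarrow> real"
  assumes "is_interval S" "\<And>x. x \<in> S \<Longrightarrow> (F has_real_derivative D x) (at x)"
    "\<And>x. x \<in> S \<Longrightarrow> (G has_real_derivative D x) (at x)"
  shows "\<exists>c. \<forall>x\<in>S. F x = G x + c"
proof -
  have "\<exists>c. \<forall>x\<in>S. F x - G x = c"
  proof (rule has_field_derivative_zero_constant)
    show "convex S" using assms(1) by (simp add: is_interval_convex)
    show "((\<lambda>x. F x - G x) has_real_derivative 0) (at x within S)" if "x \<in> S" for x
      using DERIV_diff[OF assms(2,3)[OF that]] by (auto intro: has_field_derivative_at_within)
  qed
  then show ?thesis by (auto simp: algebra_simps)
qed

lemma has_derivative_interval_integral: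
  fixes h :: "real \<Rightarrow> real"
  assumes h: "continuous_on UNIV h"
  shows "((\<lambda>u. LBINT x=0..ereal u. h x) has_real_derivative h u) (at u)"
proof -
  \<comment> \<open>The interval contains the base point 0 whatever the sign of \<open>u\<close>,
    and has \<open>u\<close> in its interior, so the derivative within it is the full derivative at
    \<open>u\<close>.\<close>
  define l r where "l = min 0 u - 1" "r = max 0 u + 1"
  have lr: "l < 0" "0 < r" "l < u" "u < r" by (auto simp: l_r_def)
  have "((\<lambda>u. LBINT x=ereal 0..ereal u. h x) has_vector_derivative h u) (at u within {l..r})"
    using lr h by (intro interval_integral_FTC2) (auto intro: continuous_on_subset)
  then show ?thesis
    using lr at_within_Icc_at[of l u r]
    by (simp add: has_real_derivative_iff_has_vector_derivative zero_ereal_def)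
qed

section \<open>The profile curve of a surface of constant positive curvature\<close>

lemma rotational_surface_derivs:
  assumes S: "rotational_surface I f g" and u: "u \<in> I"
  shows "(f has_real_derivative deriv f u) (at u)"
    "(deriv f has_real_derivative deriv (deriv f) u) (at u)"
    "(g has_real_derivative deriv g u) (at u)"
    "(deriv g has_real_derivative deriv (deriv g) u) (at u)"
proof -
  have D: "(h has_real_derivative deriv h u) (at u)" if "h differentiable_on I" for h :: "real \<Rightarrow> real"
    using that u S unfolding rotational_surface_def
    by (metis DERIV_deriv_iff_real_differentiable at_within_open differentiable_on_def)
  have "f differentiable_on I" "deriv f differentiable_on I"
    "g differentiable_on I" "deriv g differentiable_on I"
    using S by (auto simp: rotational_surface_def twice_differentiable_on_def)
  then show "(f has_real_derivative deriv f u) (at u)"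
    "(deriv f has_real_derivative deriv (deriv f) u) (at u)"
    "(g has_real_derivative deriv g u) (at u)"
    "(deriv g has_real_derivative deriv (deriv g) u) (at u)"
    by (auto intro: D)
qed

lemma constant_curvature_profile_ode:
  assumes S: "rotational_surface I f g" and u: "u \<in> I"
    and K: "gaussian_curvature (rot f g) u v = K"
  shows "deriv (deriv f) u = - K * f u"
  using gaussian_curvature_rot[OF S u, of v] rotational_surface_nonzero[OF S u] K
  by (simp add: field_simps)

text \<open>The equation \<open>f'' = - k\<^sup>2 f\<close> makes the vector
  \<open>(f, f' / k)\<close> rotate with angular speed \<open>k\<close>. Undoing this rotation,
  starting from \<open>s\<^sub>0\<close>, leaves a constant vector, whose entries are the
  coefficients \<open>A\<close> and \<open>B\<close>.\<close>

lemma trig_profile_exists: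
  assumes S: "rotational_surface I f g" and K: "K > 0"
    and curv: "\<And>u v. u \<in> I \<Longrightarrow> gaussian_curvature (rot f g) u v = K"
    and s0: "s\<^sub>0 \<in> I"
  shows "\<exists>A B. trig_profile I f K s\<^sub>0 A B"
proof -
  define k where "k = sqrt K"
  have k: "k > 0" "K = k * k" using K by (auto simp: k_def)
  have int: "is_interval I" using S by (simp add: rotational_surface_def)
  note d = rotational_surface_derivs[OF S]
  have ode: "deriv (deriv f) u = - (k * k) * f u" if "u \<in> I" for u
    using constant_curvature_profile_ode[OF S that curv[OF that]] k by simp
  have nz: "f u \<noteq> 0" if "u \<in> I" for u
    using rotational_surface_nonzero[OF S that] .
  \<comment> \<open>\<open>P\<close> and \<open>Q\<close> are the entries of
    \<open>(f, f' / k)\<close> rotated back by the angle \<open>k * (u - s\<^sub>0)\<close>.\<close>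
  define P where "P u = f u * cos (k * (u - s\<^sub>0)) - deriv f u / k * sin (k * (u - s\<^sub>0))" for u
  define Q where "Q u = f u * sin (k * (u - s\<^sub>0)) + deriv f u / k * cos (k * (u - s\<^sub>0))" for u
  have "(P has_real_derivative 0) (at u)" if "u \<in> I" for u
    unfolding P_def[abs_def] using k
    by (auto intro!: derivative_eq_intros d that simp: ode[OF that] field_simps)
  then obtain p where p: "P u = p" if "u \<in> I" for u
    using equal_derivs_differ_by_constant[OF int, of P "\<lambda>_. 0" "\<lambda>_. 0"] by auto
  have "(Q has_real_derivative 0) (at u)" if "u \<in> I" for u
    unfolding Q_def[abs_def] using k
    by (auto intro!: derivative_eq_intros d that simp: ode[OF that] field_simps)
  then obtain q where q: "Q u = q" if "u \<in> I" for u
    using equal_derivs_differ_by_constant[OF int, of Q "\<lambda>_. 0" "\<lambda>_. 0"] by auto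
  have f: "f u = p * cos (k * (u - s\<^sub>0)) + q * sin (k * (u - s\<^sub>0))" if "u \<in> I" for u
  proof -
    \<comment> \<open>Rotating forward again recovers \<open>f\<close> from the constants.\<close>
    have "P u * cos (k * (u - s\<^sub>0)) + Q u * sin (k * (u - s\<^sub>0))
        = f u * ((sin (k * (u - s\<^sub>0)))\<^sup>2 + (cos (k * (u - s\<^sub>0)))\<^sup>2)"
      unfolding P_def Q_def by algebra
    then show ?thesis using p[OF that] q[OF that] by simp
  qed
  \<comment> \<open>The sign condition in \<open>trig_profile\<close> holds because the first
    coefficient is the value \<open>f s\<^sub>0\<close> and \<open>f\<close> keeps its sign on
    \<open>I\<close>. The latter follows from the constant sign of \<open>f''\<close>, a multiple of
    \<open>f\<close> by a negative constant.\<close>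
  have "deriv (deriv f) u \<noteq> 0" if "u \<in> I" for u using ode[OF that] nz[OF that] k by simp
  then obtain \<sigma> where \<sigma>: "\<sigma> \<in> {1, -1}" "\<And>u. u \<in> I \<Longrightarrow> \<sigma> * deriv (deriv f) u > 0"
    using nonzero_deriv_constant_sign[OF int d(2)] by blast
  have "p * f u > 0" if "u \<in> I" for u
  proof -
    have "p = f s\<^sub>0" using f[OF s0] by simp
    moreover have "(\<sigma> * deriv (deriv f) s\<^sub>0) * (\<sigma> * deriv (deriv f) u) > 0"
      using \<sigma>(2)[OF s0] \<sigma>(2)[OF that] by (rule mult_pos_pos)
    moreover have "(\<sigma> * deriv (deriv f) s\<^sub>0) * (\<sigma> * deriv (deriv f) u)
        = (k * k)\<^sup>2 * (f s\<^sub>0 * f u)"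
      using \<sigma>(1) by (auto simp: ode[OF s0] ode[OF that] power2_eq_square)
    ultimately show ?thesis using k by (simp add: zero_less_mult_iff)
  qed
  with f show ?thesis unfolding trig_profile_def k_def by blast
qed

text \<open>The factor \<open>sqrt K\<^sub>0\<close> is pulled out so that the square of this
  derivative is exactly the term subtracted under the root in the height integral.\<close>

lemma trig_profile_deriv:
  assumes "trig_profile I f K s\<^sub>0 A B" "open I" "u \<in> I"
  shows "deriv f u = - sqrt K * (A * sin (sqrt K * (u - s\<^sub>0)) - B * cos (sqrt K * (u - s\<^sub>0)))"
proof (rule DERIV_imp_deriv)
  have "((\<lambda>u. A * cos (sqrt K * (u - s\<^sub>0)) + B * sin (sqrt K * (u - s\<^sub>0))) has_real_derivative
      - sqrt K * (A * sin (sqrt K * (u - s\<^sub>0)) - B * cos (sqrt K * (u - s\<^sub>0)))) (at u)"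
    by (auto intro!: derivative_eq_intros simp: algebra_simps)
  then show "(f has_real_derivative
      - sqrt K * (A * sin (sqrt K * (u - s\<^sub>0)) - B * cos (sqrt K * (u - s\<^sub>0)))) (at u)"
    by (rule has_field_derivative_transform_within_open[OF _ assms(2,3)])
      (use assms(1) in \<open>auto simp: trig_profile_def\<close>)
qed

text \<open>Unit speed gives \<open>g'\<close> up to a sign at each point; a single sign on all of
  \<open>I\<close> is what allows one factor in front of the whole height integral.\<close>

lemma height_constant_sign:
  assumes S: "rotational_surface I f g"
    and nz: "\<And>u. u \<in> I \<Longrightarrow> deriv (deriv f) u \<noteq> 0"
  shows "\<exists>\<sigma>\<in>{1, -1}. \<forall>u\<in>I. deriv g u = \<sigma> * sqrt (1 - (deriv f u)\<^sup>2)"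
proof -
  have I: "open I" "is_interval I" using S by (auto simp: rotational_surface_def)
  note d = rotational_surface_derivs[OF S]
  have unit: "(deriv f u)\<^sup>2 + (deriv g u)\<^sup>2 = 1" if "u \<in> I" for u
    using S that by (simp add: rotational_surface_def)
  have "deriv g u \<noteq> 0" if u: "u \<in> I" for u
  proof
    assume 0: "deriv g u = 0"
    have "((\<lambda>x. (deriv f x)\<^sup>2 + (deriv g x)\<^sup>2) has_real_derivative
        2 * deriv f u * deriv (deriv f) u + 2 * deriv g u * deriv (deriv g) u) (at u)"
      by (auto intro!: derivative_eq_intros d u)
    moreover have "((\<lambda>x. (deriv f x)\<^sup>2 + (deriv g x)\<^sup>2) has_real_derivative 0) (at u)"
      by (rule has_field_derivative_transform_within_open[OF DERIV_const[of 1] I(1) u]) (simp add: unit)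
    ultimately have "2 * deriv f u * deriv (deriv f) u + 2 * deriv g u * deriv (deriv g) u = 0"
      using DERIV_unique by blast
    \<comment> \<open>Where \<open>g' = 0\<close>, unit speed gives \<open>f'\<^sup>2 = 1\<close>,
      so the equation just derived would force \<open>f'' = 0\<close>.\<close>
    then show False using 0 nz[OF u] unit[OF u] by simp
  qed
  then obtain \<sigma> where \<sigma>: "\<sigma> \<in> {1, -1}" "\<And>u. u \<in> I \<Longrightarrow> \<sigma> * deriv g u > 0"
    using nonzero_deriv_constant_sign[OF I(2) d(3)] by blast
  have "deriv g u = \<sigma> * sqrt (1 - (deriv f u)\<^sup>2)" if "u \<in> I" for u
  proof -
    have "1 - (deriv f u)\<^sup>2 = (\<sigma> * deriv g u)\<^sup>2"
      using unit[OF that] \<sigma>(1) by (auto simp: power2_eq_square)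
    then have "sqrt (1 - (deriv f u)\<^sup>2) = \<sigma> * deriv g u"
      using \<sigma>(2)[OF that] by simp
    then show ?thesis using \<sigma>(1) by auto
  qed
  with \<sigma>(1) show ?thesis by blast
qed

section \<open>Differential equations of a loxodrome\<close>

text \<open>The tangent is \<open>s'\<close> times the meridian direction plus
  \<open>\<theta>'\<close> times the parallel direction; these are orthogonal with lengths 1 and
  \<open>\<bar>f\<bar>\<close>. Hence the component along the meridian, \<open>s'\<close>, is the
  cosine of the angle, and unit speed leaves the square of the sine for the other component.\<close>

lemma loxodrome_derivs:
  assumes S: "rotational_surface I f g" and lox: "loxodrome I f g \<psi> J s \<theta> \<alpha>" and t: "t \<in> J"
  shows "(s has_real_derivative cos \<psi>) (at t)"
    and "(\<theta> has_real_derivative deriv \<theta> t) (at t)"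
    and "(f (s t) * deriv \<theta> t)\<^sup>2 = (sin \<psi>)\<^sup>2"
proof -
  have J: "open J" using lox by (simp add: loxodrome_def)
  have sI: "s t \<in> I" using lox t by (auto simp: loxodrome_def)
  note d = rotational_surface_derivs[OF S sI]
  have D: "(h has_real_derivative deriv h t) (at t)" if "h differentiable_on J" for h :: "real \<Rightarrow> real"
    using that t J
    by (metis DERIV_deriv_iff_real_differentiable at_within_open differentiable_on_def)
  have ds: "(s has_real_derivative deriv s t) (at t)" and d\<theta>: "(\<theta> has_real_derivative deriv \<theta> t) (at t)"
    using lox by (auto intro!: D simp: loxodrome_def)
  show "(\<theta> has_real_derivative deriv \<theta> t) (at t)" by (fact d\<theta>)
  have unit: "(deriv f (s t))\<^sup>2 + (deriv g (s t))\<^sup>2 = 1"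
    using S sI by (simp add: rotational_surface_def)
  define F F' G' C Sn s' \<theta>' where "F = f (s t)" "F' = deriv f (s t)" "G' = deriv g (s t)"
    "C = cos (\<theta> t)" "Sn = sin (\<theta> t)" "s' = deriv s t" "\<theta>' = deriv \<theta> t"
  note defs = this[symmetric]
  have cs: "C\<^sup>2 + Sn\<^sup>2 = 1" by (simp add: F_F'_G'_C_Sn_s'_\<theta>'_def)
  have un: "F'\<^sup>2 + G'\<^sup>2 = 1" using unit by (simp add: defs)
  define v :: "real^3" where
    "v = vector [F' * s' * C - F * Sn * \<theta>', F' * s' * Sn + F * C * \<theta>', G' * s']"
  have df: "((\<lambda>t. f (s t)) has_real_derivative deriv f (s t) * deriv s t) (at t)"
    using d(1) ds by (rule DERIV_chain2)
  have dg: "((\<lambda>t. g (s t)) has_real_derivative deriv g (s t) * deriv s t) (at t)"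
    using d(3) ds by (rule DERIV_chain2)
  have "((\<lambda>t. rot f g (s t) (\<theta> t)) has_vector_derivative v) (at t)"
    unfolding rot_def v_def
    by (rule vec3_hvd)
      (auto intro!: derivative_eq_intros df[unfolded defs] dg[unfolded defs] d\<theta> simp: defs algebra_simps)
  then have "(\<alpha> has_vector_derivative v) (at t)"
    by (rule has_vector_derivative_transform_within_open[OF _ J t])
      (use lox in \<open>simp add: loxodrome_def\<close>)
  then have v: "vector_derivative \<alpha> (at t) = v" by (rule vector_derivative_at)
  have p: "partial1 (rot f g) (s t) (\<theta> t) = vector [F' * C, F' * Sn, G']"
    unfolding partial1_def rot_def
    by (rule vector_derivative_at, rule vec3_hvd)
      (auto intro!: derivative_eq_intros d[unfolded defs] simp: defs)
  have np: "norm (partial1 (rot f g) (s t) (\<theta> t)) = 1"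
    unfolding norm_eq_1 p using cs un by (simp add: inner_vec_def sum_3) algebra
  have nv: "norm v = 1" using lox t v by (auto simp: loxodrome_def)
  have vv: "v \<bullet> v = s'\<^sup>2 + (F * \<theta>')\<^sup>2"
    unfolding v_def using cs un by (simp add: inner_vec_def sum_3) algebra
  have vp: "v \<bullet> partial1 (rot f g) (s t) (\<theta> t) = s'"
    unfolding v_def p using cs un by (simp add: inner_vec_def sum_3) algebra
  have one: "s'\<^sup>2 + (F * \<theta>')\<^sup>2 = 1" using nv vv by (simp add: norm_eq_1)
  have "angle_between v (partial1 (rot f g) (s t) (\<theta> t)) = \<psi>"
    using lox t v by (auto simp: loxodrome_def)
  then have "arccos s' = \<psi>" by (simp add: angle_between_def vp nv np)
  \<comment> \<open>\<open>arccos\<close> is inverted by \<open>cos\<close> only on the interval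
    from -1 to 1; the bound comes from \<open>s'\<close> being the inner product of two unit
    vectors.\<close>
  moreover have "\<bar>s'\<bar> \<le> 1" using Cauchy_Schwarz_ineq2[of v "partial1 (rot f g) (s t) (\<theta> t)"] vp nv np by simp
  ultimately have s': "s' = cos \<psi>" using cos_arccos_abs[of s'] by simp
  then show "(s has_real_derivative cos \<psi>) (at t)" using ds by (simp add: defs)
  have "(F * \<theta>')\<^sup>2 = (sin \<psi>)\<^sup>2" using one unfolding s' cos_squared_eq by simp
  then show "(f (s t) * deriv \<theta> t)\<^sup>2 = (sin \<psi>)\<^sup>2" by (simp add: defs)
qed

text \<open>Taking the root of \<open>(f \<theta>')\<^sup>2 = (sin \<psi>)\<^sup>2\<close> with one
  sign on all of \<open>J\<close> requires that neither \<open>f\<close> nor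
  \<open>\<theta>'\<close> changes sign; \<open>c\<close> records the sign of
  \<open>f\<close>.\<close>

lemma loxodrome_angle_deriv:
  assumes S: "rotational_surface I f g" and lox: "loxodrome I f g \<psi> J s \<theta> \<alpha>"
    and \<psi>: "\<psi> \<in> {0..pi}" and c: "c \<in> {1, -1}" "\<And>u. u \<in> I \<Longrightarrow> c * f u > 0"
  shows "\<exists>\<epsilon>\<in>{1, -1}. \<forall>t\<in>J. (\<theta> has_real_derivative \<epsilon> * sin \<psi> / f (s t)) (at t)"
proof -
  have int: "is_interval J" using lox by (simp add: loxodrome_def)
  have sI: "s t \<in> I" if "t \<in> J" for t using lox that by (auto simp: loxodrome_def)
  note d = loxodrome_derivs[OF S lox]
  have f: "c * f (s t) > 0" "f (s t) \<noteq> 0" if "t \<in> J" for t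
    using c(2)[OF sI[OF that]] by auto
  show ?thesis
  \<comment> \<open>If the sine vanishes, the curve runs along a meridian with
    \<open>\<theta>' = 0\<close>, and either choice of \<open>\<epsilon>\<close> works. Otherwise
    \<open>\<theta>'\<close> has no zeros and Darboux gives its sign.\<close>
  proof (cases "sin \<psi> = 0")
    case True
    then have "deriv \<theta> t = 0" if "t \<in> J" for t using d(3)[OF that] f[OF that] by simp
    then show ?thesis using d(2) True by auto
  next
    case False
    then have sin: "sin \<psi> > 0" using \<psi> sin_ge_zero[of \<psi>] by auto
    have "deriv \<theta> t \<noteq> 0" if "t \<in> J" for t using d(3)[OF that] False by auto
    then obtain \<sigma> where \<sigma>: "\<sigma> \<in> {1, -1}" "\<And>t. t \<in> J \<Longrightarrow> \<sigma> * deriv \<theta> t > 0"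
      using nonzero_deriv_constant_sign[OF int d(2)] by blast
    \<comment> \<open>The sign sought is the product of the signs of \<open>\<theta>'\<close> and
      \<open>f\<close>: both \<open>c * f\<close> and \<open>\<sigma> * \<theta>'\<close> are
      positive, so their product is the nonnegative root \<open>sin \<psi>\<close>.\<close>
    have "deriv \<theta> t = (\<sigma> * c) * sin \<psi> / f (s t)" if t: "t \<in> J" for t
    proof -
      have "((c * f (s t)) * (\<sigma> * deriv \<theta> t))\<^sup>2 = (sin \<psi>)\<^sup>2"
        using d(3)[OF t] c(1) \<sigma>(1) by (auto simp: power_mult_distrib)
      moreover have "(c * f (s t)) * (\<sigma> * deriv \<theta> t) > 0"
        using f(1)[OF t] \<sigma>(2)[OF t] by (rule mult_pos_pos)
      ultimately have "(c * f (s t)) * (\<sigma> * deriv \<theta> t) = sin \<psi>"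
        using sin by (simp add: power2_eq_iff_nonneg)
      then show ?thesis using f(2)[OF t] c(1) \<sigma>(1) by (auto simp: field_simps)
    qed
    moreover have "\<sigma> * c \<in> {1, -1}" using \<sigma>(1) c(1) by auto
    ultimately show ?thesis using d(2) by metis
  qed
qed

section \<open>Half-angle antiderivatives of the reciprocal of the profile radius\<close>

text \<open>With \<open>y = x / 2\<close>, the logarithmic derivative of \<open>tan y\<close> is
  \<open>y' / (sin y * cos y) = x' / sin x\<close>. The condition on \<open>sin x\<close> keeps
  \<open>y\<close> away from both the zeros and the poles of \<open>tan\<close>.\<close>

lemma has_derivative_ln_abs_tan_half:
  assumes x: "(x has_real_derivative x') (at t)" and nz: "sin (x t) \<noteq> 0"
  shows "((\<lambda>t. ln \<bar>tan (1 / 2 * x t)\<bar>) has_real_derivative x' / sin (x t)) (at t)"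
proof -
  define y where "y = 1 / 2 * x t"
  have sin: "sin (x t) = 2 * sin y * cos y" using sin_double[of y] by (simp add: y_def)
  with nz have y: "sin y \<noteq> 0" "cos y \<noteq> 0" by auto
  then have tan: "tan y \<noteq> 0" by (simp add: tan_def)
  have ln: "((\<lambda>y. ln \<bar>y\<bar>) has_real_derivative 1 / w) (at w)" if "w \<noteq> 0" for w :: real
  proof (cases "w > 0")
    case True
    then have "(ln has_real_derivative 1 / w) (at w)" by (rule DERIV_ln_divide)
    then show ?thesis
      by (rule has_field_derivative_transform_within_open[of _ _ _ "{0<..}"]) (use True in auto)
  next
    case False
    then have "w < 0" using that by simp
    then have "((\<lambda>y. ln (- y)) has_real_derivative 1 / w) (at w)"
      by (auto intro!: derivative_eq_intros simp: field_simps)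
    then show ?thesis
      by (rule has_field_derivative_transform_within_open[of _ _ _ "{..<0}"]) (use \<open>w < 0\<close> in auto)
  qed
  have dt: "((\<lambda>t. tan (1 / 2 * x t)) has_real_derivative inverse ((cos y)\<^sup>2) * (1 / 2 * x')) (at t)"
    using y by (auto intro!: derivative_eq_intros x simp: y_def)
  have "((\<lambda>t. ln \<bar>tan (1 / 2 * x t)\<bar>) has_real_derivative
      1 / tan y * (inverse ((cos y)\<^sup>2) * (1 / 2 * x'))) (at t)"
    using DERIV_chain2[OF ln dt] tan by (simp add: y_def)
  moreover have "1 / tan y * (inverse ((cos y)\<^sup>2) * (1 / 2 * x')) = x' / sin (x t)"
    unfolding sin using y by (simp add: tan_def field_simps power2_eq_square)
  ultimately show ?thesis by simp
qed

text \<open>With \<open>y = x / 2\<close>, the factor \<open>1 - w\<^sup>2\<close> in the derivative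
  of \<open>artanh w\<close> becomes \<open>A * f\<close> after multiplication by
  \<open>(R * cos y)\<^sup>2\<close>. The positivity assumption thus gives
  \<open>\<bar>w\<bar> < 1\<close>, and the same identity turns the chain rule into a multiple of
  \<open>1 / f\<close>.\<close>

lemma has_derivative_artanh_tan_half:
  assumes x: "(x has_real_derivative x') (at t)"
    and pos: "A * (A * cos (x t) + B * sin (x t)) > 0"
  shows "((\<lambda>t. artanh (1 / sqrt (A\<^sup>2 + B\<^sup>2) * (A * tan (1 / 2 * x t) - B))) has_real_derivative
    sqrt (A\<^sup>2 + B\<^sup>2) * x' / (2 * (A * cos (x t) + B * sin (x t)))) (at t)"
proof -
  define y where "y = 1 / 2 * x t"
  define R where "R = sqrt (A\<^sup>2 + B\<^sup>2)"
  have A: "A \<noteq> 0" using pos by auto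
  then have R: "R > 0" "R\<^sup>2 = A\<^sup>2 + B\<^sup>2" by (auto simp: R_def sum_power2_gt_zero_iff)
  have sin: "sin (x t) = 2 * sin y * cos y" and cos: "cos (x t) = (cos y)\<^sup>2 - (sin y)\<^sup>2"
    using sin_double[of y] cos_double[of y] by (auto simp: y_def)
  \<comment> \<open>At a pole of \<open>tan y\<close> the combination equals \<open>- A\<close>,
    which contradicts the assumed sign.\<close>
  have cy: "cos y \<noteq> 0"
  proof
    assume "cos y = 0"
    then have "A * (A * cos (x t) + B * sin (x t)) = - (A * sin y)\<^sup>2"
      unfolding sin cos by (simp add: power2_eq_square algebra_simps)
    then show False using pos by (metis neg_0_less_iff_less not_sum_power2_lt_zero power_zero_numeral
      add.right_neutral)
  qed
  define f where "f = A * cos (x t) + B * sin (x t)"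
  define w where "w = 1 / R * (A * tan y - B)"
  \<comment> \<open>Since \<open>w * (R * cos y) = A * sin y - B * cos y\<close>, expanding cancels
    the terms in \<open>B\<^sup>2\<close>; the rest is \<open>A\<close> times the double-angle form
    of \<open>f\<close>.\<close>
  have key: "(1 - w\<^sup>2) * (R * cos y)\<^sup>2 = A * f"
  proof -
    have "w * (R * cos y) = A * sin y - B * cos y"
      using R cy by (simp add: w_def tan_def field_simps)
    then have "(1 - w\<^sup>2) * (R * cos y)\<^sup>2 = (A\<^sup>2 + B\<^sup>2) * (cos y)\<^sup>2 - (A * sin y - B * cos y)\<^sup>2"
      using R(2) by (simp add: left_diff_distrib flip: power_mult_distrib) (simp add: power_mult_distrib)
    then show ?thesis unfolding f_def sin cos by (simp add: power2_eq_square algebra_simps)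
  qed
  then have "1 - w\<^sup>2 > 0" using pos R cy f_def by (metis zero_less_mult_pos2 zero_less_power2
    mult_eq_0_iff)
  then have w: "\<bar>w\<bar> < 1" "1 - w\<^sup>2 \<noteq> 0" using abs_square_less_1[of w] by auto
  have f: "f \<noteq> 0" using pos f_def by auto
  have dw: "((\<lambda>t. 1 / R * (A * tan (1 / 2 * x t) - B)) has_real_derivative
      1 / R * (A * (inverse ((cos y)\<^sup>2) * (1 / 2 * x')))) (at t)"
    using cy R(1) by (auto intro!: derivative_eq_intros x simp: y_def mult_ac)
  have "((\<lambda>t. artanh (1 / R * (A * tan (1 / 2 * x t) - B))) has_real_derivative
      1 / (1 - w\<^sup>2) * (1 / R * (A * (inverse ((cos y)\<^sup>2) * (1 / 2 * x'))))) (at t)"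
    by (rule DERIV_chain2[OF _ dw]) (use artanh_real_has_field_derivative[OF w(1), of UNIV] in \<open>simp add: w_def y_def\<close>)
  moreover have "1 / (1 - w\<^sup>2) * (1 / R * (A * (inverse ((cos y)\<^sup>2) * (1 / 2 * x')))) = R * x' / (2 * f)"
  proof -
    have "1 / (1 - w\<^sup>2) * (1 / R * (A * (inverse ((cos y)\<^sup>2) * (1 / 2 * x'))))
        = R * A * x' / (2 * ((1 - w\<^sup>2) * (R * cos y)\<^sup>2))"
      using R cy w by (simp add: field_simps power2_eq_square)
    also have "\<dots> = R * x' / (2 * f)" unfolding key using A f by simp
    finally show ?thesis .
  qed
  ultimately show ?thesis by (simp add: R_def f_def)
qed

section \<open>Assembly of the parametrization from profile, height and angle\<close>

text \<open>The first conjunct keeps the second from being vacuous; the second covers every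
  representation of the profile, with \<open>s\<^sub>0\<close> possibly outside \<open>I\<close>.
  The constant \<open>z\<^sub>0\<close> is a vertical translation, since only \<open>g'\<close> is
  determined. The excluded angle belongs to parallels, for which \<open>tan \<psi>\<close> has no
  meaning.\<close>

theorem theorem6:
  fixes f g s \<theta> :: "real \<Rightarrow> real" and \<alpha> :: "real \<Rightarrow> real^3"
    and I J :: "real set" and K\<^sub>0 \<psi> :: real
  assumes surface: "rotational_surface I f g"
    and K0_pos: "K\<^sub>0 > 0"
    and curvature: "\<And>u v. u \<in> I \<Longrightarrow> gaussian_curvature (rot f g) u v = K\<^sub>0"
    and psi: "\<psi> \<in> {0..pi}" "\<psi> \<noteq> pi / 2"
    and lox: "loxodrome I f g \<psi> J s \<theta> \<alpha>"
  shows "(\<forall>s\<^sub>0\<in>I. \<exists>A B. trig_profile I f K\<^sub>0 s\<^sub>0 A B) \<and>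
    (\<forall>s\<^sub>0 A B. trig_profile I f K\<^sub>0 s\<^sub>0 A B \<longrightarrow>
      (\<exists>a a\<^sub>0 c \<theta>\<^sub>0 z\<^sub>0 \<epsilon> \<sigma> :: real.
        a = cos \<psi> \<and> a\<^sub>0 = c * sqrt K\<^sub>0 \<and> \<epsilon> \<in> {1, -1} \<and> \<sigma> \<in> {1, -1} \<and>
        (\<forall>t\<in>J. s t = s\<^sub>0 + (a * t + c)) \<and>
        (\<forall>u\<in>I. g u = z\<^sub>0 + \<sigma> * (LBINT \<xi>=0..u - s\<^sub>0.
            sqrt (1 - K\<^sub>0 * (A * sin (sqrt K\<^sub>0 * \<xi>) - B * cos (sqrt K\<^sub>0 * \<xi>))\<^sup>2))) \<and>
        (\<forall>t\<in>J. \<alpha> t = vector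
          [(A * cos (a * sqrt K\<^sub>0 * t + a\<^sub>0) + B * sin (a * sqrt K\<^sub>0 * t + a\<^sub>0)) * cos (\<theta> t),
           (A * cos (a * sqrt K\<^sub>0 * t + a\<^sub>0) + B * sin (a * sqrt K\<^sub>0 * t + a\<^sub>0)) * sin (\<theta> t),
           z\<^sub>0 + \<sigma> * (LBINT \<xi>=0..a * t + c.
            sqrt (1 - K\<^sub>0 * (A * sin (sqrt K\<^sub>0 * \<xi>) - B * cos (sqrt K\<^sub>0 * \<xi>))\<^sup>2))]) \<and>
        ((A = 0 \<and> B \<noteq> 0 \<and>
          (\<forall>t\<in>J. \<theta> t = \<epsilon> * tan \<psi> / (B * sqrt K\<^sub>0)
              * ln \<bar>tan (1 / 2 * (a * sqrt K\<^sub>0 * t + a\<^sub>0))\<bar> + \<theta>\<^sub>0)) \<or>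
         (A \<noteq> 0 \<and>
          (\<forall>t\<in>J. \<theta> t = 2 * \<epsilon> * tan \<psi> / sqrt (K\<^sub>0 * (A\<^sup>2 + B\<^sup>2))
              * artanh (1 / sqrt (A\<^sup>2 + B\<^sup>2)
                  * (A * tan (1 / 2 * (a * sqrt K\<^sub>0 * t + a\<^sub>0)) - B)) + \<theta>\<^sub>0)))))"
proof (intro conjI ballI allI impI)
  show "\<exists>A B. trig_profile I f K\<^sub>0 s\<^sub>0 A B" if "s\<^sub>0 \<in> I" for s\<^sub>0
    using trig_profile_exists[OF surface K0_pos curvature that] .
next
  fix s\<^sub>0 A B :: real
  assume prof: "trig_profile I f K\<^sub>0 s\<^sub>0 A B"
  define k where "k = sqrt K\<^sub>0"
  have k: "k > 0" "K\<^sub>0 = k\<^sup>2" using K0_pos by (auto simp: k_def)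
  define a where "a = cos \<psi>"
  have a0: "a \<noteq> 0"
  proof
    assume "a = 0"
    then have "\<psi> = pi / 2" using psi(1) cos_inj_pi[of \<psi> "pi / 2"] by (simp add: a_def)
    then show False using psi(2) by contradiction
  qed
  have I: "open I" "is_interval I" using surface by (auto simp: rotational_surface_def)
  have J: "is_interval J" using lox by (simp add: loxodrome_def)
  have sI: "s t \<in> I" if "t \<in> J" for t using lox that by (auto simp: loxodrome_def)
  have f: "f u = A * cos (k * (u - s\<^sub>0)) + B * sin (k * (u - s\<^sub>0))" if "u \<in> I" for u
    using prof that by (simp add: trig_profile_def k_def)
  have f0: "f u \<noteq> 0" if "u \<in> I" for u using rotational_surface_nonzero[OF surface that] .
  note d = rotational_surface_derivs[OF surface]
  have ode: "deriv (deriv f) u = - K\<^sub>0 * f u" if "u \<in> I" for u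
    using constant_curvature_profile_ode[OF surface that curvature[OF that]] .
  have f''0: "deriv (deriv f) u \<noteq> 0" if "u \<in> I" for u using ode[OF that] f0[OF that] K0_pos by simp
  obtain \<sigma> where \<sigma>: "\<sigma> \<in> {1, -1}" "\<And>u. u \<in> I \<Longrightarrow> deriv g u = \<sigma> * sqrt (1 - (deriv f u)\<^sup>2)"
    using height_constant_sign[OF surface f''0] by blast
  \<comment> \<open>\<open>trig_profile\<close> fixes the sign of \<open>f\<close> only for
    \<open>A \<noteq> 0\<close>, so in general it is read off from
    \<open>f'' = - K\<^sub>0 f\<close>: the sign of \<open>f\<close> is
    \<open>- \<tau>\<close>.\<close>
  obtain \<tau> where \<tau>: "\<tau> \<in> {1, -1}" "\<And>u. u \<in> I \<Longrightarrow> \<tau> * deriv (deriv f) u > 0"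
    using nonzero_deriv_constant_sign[OF I(2) d(2) f''0] by blast
  have f_sign: "- \<tau> * f u > 0" if "u \<in> I" for u
    using \<tau>(2)[OF that] ode[OF that] K0_pos
    by (auto simp: mult_less_0_iff zero_less_mult_iff)
  have "- \<tau> \<in> {1, -1}" using \<tau>(1) by auto
  then obtain \<epsilon> where \<epsilon>: "\<epsilon> \<in> {1, -1}"
    "\<And>t. t \<in> J \<Longrightarrow> (\<theta> has_real_derivative \<epsilon> * sin \<psi> / f (s t)) (at t)"
    using loxodrome_angle_deriv[OF surface lox psi(1) _ f_sign] by blast

  have "\<exists>c'. \<forall>t\<in>J. s t = a * t + c'"
    by (rule equal_derivs_differ_by_constant[OF J, of _ "\<lambda>_. a"])
      (auto intro!: derivative_eq_intros loxodrome_derivs(1)[OF surface lox] simp: a_def)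
  then obtain c' where c': "\<And>t. t \<in> J \<Longrightarrow> s t = a * t + c'" by blast
  \<comment> \<open>The shift makes \<open>a * t + c\<close> the meridian arc length measured from
    \<open>s\<^sub>0\<close>; the phase \<open>a\<^sub>0 = c * k\<close> then makes
    \<open>x t\<close> the argument of the trigonometric profile along the curve.\<close>
  define c where "c = c' - s\<^sub>0"
  have s: "s t = s\<^sub>0 + (a * t + c)" if "t \<in> J" for t using c'[OF that] by (simp add: c_def)
  define a\<^sub>0 where "a\<^sub>0 = c * k"
  define x where "x t = a * k * t + a\<^sub>0" for t
  have x: "k * (s t - s\<^sub>0) = x t" if "t \<in> J" for t
    using s[OF that] by (simp add: x_def a\<^sub>0_def algebra_simps)
  have dx: "(x has_real_derivative a * k) (at t)" for t
    unfolding x_def[abs_def] by (auto intro!: derivative_eq_intros)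
  have fx: "f (s t) = A * cos (x t) + B * sin (x t)" if "t \<in> J" for t
    using f[OF sI[OF that]] x[OF that] by simp

  define h where "h \<xi> = sqrt (1 - K\<^sub>0 * (A * sin (k * \<xi>) - B * cos (k * \<xi>))\<^sup>2)" for \<xi>
  \<comment> \<open>The radicand may be negative outside the shifted interval \<open>I\<close>, but
    \<open>sqrt\<close> is continuous on all reals in HOL, so integrating from 0 is legitimate even
    if \<open>s\<^sub>0\<close> lies outside \<open>I\<close>; \<open>z\<^sub>0\<close> absorbs the
    difference.\<close>
  have h: "continuous_on UNIV h" unfolding h_def[abs_def] by (intro continuous_intros)
  define H where "H u = (LBINT \<xi>=0..ereal u. h \<xi>)" for u
  have dH: "((\<lambda>u. \<sigma> * H (u - s\<^sub>0)) has_real_derivative \<sigma> * h (u - s\<^sub>0)) (at u)" for u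
  proof -
    have "((\<lambda>u. H (u - s\<^sub>0)) has_real_derivative h (u - s\<^sub>0) * 1) (at u)"
      unfolding H_def
      by (rule DERIV_chain2[OF has_derivative_interval_integral[OF h]])
        (auto intro!: derivative_eq_intros)
    then show ?thesis by (auto intro!: derivative_eq_intros)
  qed
  have g': "(g has_real_derivative \<sigma> * h (u - s\<^sub>0)) (at u)" if "u \<in> I" for u
  proof -
    have "(deriv f u)\<^sup>2 = K\<^sub>0 * (A * sin (k * (u - s\<^sub>0)) - B * cos (k * (u - s\<^sub>0)))\<^sup>2"
      using trig_profile_deriv[OF prof I(1) that] k by (simp add: power_mult_distrib)
    then show ?thesis using d(3)[OF that] \<sigma>(2)[OF that] by (simp add: h_def)
  qed
  obtain z\<^sub>0 where z\<^sub>0: "\<And>u. u \<in> I \<Longrightarrow> g u = \<sigma> * H (u - s\<^sub>0) + z\<^sub>0"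
    using equal_derivs_differ_by_constant[OF I(2) g' dH] by blast

  \<comment> \<open>Integrating in \<open>x\<close> instead of \<open>t\<close> divides by
    \<open>x' = a * k\<close>; this is how \<open>sin \<psi>\<close> becomes
    \<open>tan \<psi> / k\<close> in the angle formulas.\<close>
  have tan: "a * tan \<psi> = sin \<psi>" using a0 by (simp add: a_def tan_def)
  have "\<exists>\<theta>\<^sub>0. (A = 0 \<and> B \<noteq> 0 \<and>
      (\<forall>t\<in>J. \<theta> t = \<epsilon> * tan \<psi> / (B * k) * ln \<bar>tan (1 / 2 * x t)\<bar> + \<theta>\<^sub>0)) \<or>
     (A \<noteq> 0 \<and>
      (\<forall>t\<in>J. \<theta> t = 2 * \<epsilon> * tan \<psi> / sqrt (K\<^sub>0 * (A\<^sup>2 + B\<^sup>2))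
          * artanh (1 / sqrt (A\<^sup>2 + B\<^sup>2) * (A * tan (1 / 2 * x t) - B)) + \<theta>\<^sub>0))"
  proof (cases "A = 0")
    case True
    obtain t where "t \<in> J" using lox by (auto simp: loxodrome_def)
    then have B: "B \<noteq> 0" using fx[of t] f0[OF sI[of t]] True by auto
    have "((\<lambda>t. \<epsilon> * tan \<psi> / (B * k) * ln \<bar>tan (1 / 2 * x t)\<bar>) has_real_derivative
        \<epsilon> * sin \<psi> / f (s t)) (at t)" if t: "t \<in> J" for t
    proof -
      \<comment> \<open>Here the radius is \<open>B * sin (x t)\<close>, and the immersion property
        excludes its zeros.\<close>
      have sin: "sin (x t) \<noteq> 0" using fx[OF t] f0[OF sI[OF t]] True by auto
      have "\<epsilon> * tan \<psi> / (B * k) * (a * k / sin (x t)) = \<epsilon> * sin \<psi> / f (s t)"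
        unfolding fx[OF t] tan[symmetric] using True k B sin by (simp add: field_simps)
      then show ?thesis
        using DERIV_cmult[OF has_derivative_ln_abs_tan_half[OF dx sin]] by metis
    qed
    with J \<epsilon>(2) have "\<exists>\<theta>\<^sub>0. \<forall>t\<in>J. \<theta> t = \<epsilon> * tan \<psi> / (B * k) * ln \<bar>tan (1 / 2 * x t)\<bar> + \<theta>\<^sub>0"
      by (rule equal_derivs_differ_by_constant)
    with True B show ?thesis by blast
  next
    case False
    define R where "R = sqrt (A\<^sup>2 + B\<^sup>2)"
    have R: "R > 0" using False by (simp add: R_def sum_power2_gt_zero_iff)
    have KR: "sqrt (K\<^sub>0 * (A\<^sup>2 + B\<^sup>2)) = k * R" by (simp add: k_def R_def real_sqrt_mult)
    have "((\<lambda>t. 2 * \<epsilon> * tan \<psi> / (k * R) * artanh (1 / R * (A * tan (1 / 2 * x t) - B)))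
        has_real_derivative \<epsilon> * sin \<psi> / f (s t)) (at t)" if t: "t \<in> J" for t
    proof -
      \<comment> \<open>This is the sign clause of \<open>trig_profile\<close> at
        \<open>s t\<close>, which keeps the argument of \<open>artanh\<close> between -1 and
        1.\<close>
      have pos: "A * (A * cos (x t) + B * sin (x t)) > 0"
        using prof False sI[OF t] fx[OF t] by (metis trig_profile_def)
      have "2 * \<epsilon> * tan \<psi> / (k * R) * (R * (a * k) / (2 * f (s t))) = \<epsilon> * sin \<psi> / f (s t)"
        unfolding tan[symmetric] using k R f0[OF sI[OF t]] by (simp add: field_simps)
      then show ?thesis
        using DERIV_cmult[OF has_derivative_artanh_tan_half[OF dx pos]]
        unfolding R_def[symmetric] fx[OF t, symmetric] by metis
    qed
    with J \<epsilon>(2) have "\<exists>\<theta>\<^sub>0. \<forall>t\<in>J. \<theta> t = 2 * \<epsilon> * tan \<psi> / (k * R)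
        * artanh (1 / R * (A * tan (1 / 2 * x t) - B)) + \<theta>\<^sub>0"
      by (rule equal_derivs_differ_by_constant)
    with False show ?thesis unfolding KR R_def[symmetric] by blast
  qed
  then obtain \<theta>\<^sub>0 where \<theta>\<^sub>0: "(A = 0 \<and> B \<noteq> 0 \<and>
      (\<forall>t\<in>J. \<theta> t = \<epsilon> * tan \<psi> / (B * k) * ln \<bar>tan (1 / 2 * x t)\<bar> + \<theta>\<^sub>0)) \<or>
     (A \<noteq> 0 \<and>
      (\<forall>t\<in>J. \<theta> t = 2 * \<epsilon> * tan \<psi> / sqrt (K\<^sub>0 * (A\<^sup>2 + B\<^sup>2))
          * artanh (1 / sqrt (A\<^sup>2 + B\<^sup>2) * (A * tan (1 / 2 * x t) - B)) + \<theta>\<^sub>0))"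
    by blast

  have gu: "g u = z\<^sub>0 + \<sigma> * (LBINT \<xi>=0..u - s\<^sub>0. h \<xi>)" if "u \<in> I" for u
    using z\<^sub>0[OF that] by (simp add: H_def)
  have \<alpha>: "\<alpha> t = vector [(A * cos (x t) + B * sin (x t)) * cos (\<theta> t),
      (A * cos (x t) + B * sin (x t)) * sin (\<theta> t), z\<^sub>0 + \<sigma> * (LBINT \<xi>=0..a * t + c. h \<xi>)]"
    if t: "t \<in> J" for t
  proof -
    have "\<alpha> t = rot f g (s t) (\<theta> t)" using lox t by (simp add: loxodrome_def)
    moreover have "g (s t) = z\<^sub>0 + \<sigma> * (LBINT \<xi>=0..a * t + c. h \<xi>)"
      using z\<^sub>0[OF sI[OF t]] s[OF t] by (simp add: H_def)
    ultimately show ?thesis using fx[OF t] by (simp add: rot_def)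
  qed
  show "\<exists>a a\<^sub>0 c \<theta>\<^sub>0 z\<^sub>0 \<epsilon> \<sigma> :: real.
        a = cos \<psi> \<and> a\<^sub>0 = c * sqrt K\<^sub>0 \<and> \<epsilon> \<in> {1, -1} \<and> \<sigma> \<in> {1, -1} \<and>
        (\<forall>t\<in>J. s t = s\<^sub>0 + (a * t + c)) \<and>
        (\<forall>u\<in>I. g u = z\<^sub>0 + \<sigma> * (LBINT \<xi>=0..u - s\<^sub>0.
            sqrt (1 - K\<^sub>0 * (A * sin (sqrt K\<^sub>0 * \<xi>) - B * cos (sqrt K\<^sub>0 * \<xi>))\<^sup>2))) \<and>
        (\<forall>t\<in>J. \<alpha> t = vector
          [(A * cos (a * sqrt K\<^sub>0 * t + a\<^sub>0) + B * sin (a * sqrt K\<^sub>0 * t + a\<^sub>0)) * cos (\<theta> t),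
           (A * cos (a * sqrt K\<^sub>0 * t + a\<^sub>0) + B * sin (a * sqrt K\<^sub>0 * t + a\<^sub>0)) * sin (\<theta> t),
           z\<^sub>0 + \<sigma> * (LBINT \<xi>=0..a * t + c.
            sqrt (1 - K\<^sub>0 * (A * sin (sqrt K\<^sub>0 * \<xi>) - B * cos (sqrt K\<^sub>0 * \<xi>))\<^sup>2))]) \<and>
        ((A = 0 \<and> B \<noteq> 0 \<and>
          (\<forall>t\<in>J. \<theta> t = \<epsilon> * tan \<psi> / (B * sqrt K\<^sub>0)
              * ln \<bar>tan (1 / 2 * (a * sqrt K\<^sub>0 * t + a\<^sub>0))\<bar> + \<theta>\<^sub>0)) \<or>
         (A \<noteq> 0 \<and>
          (\<forall>t\<in>J. \<theta> t = 2 * \<epsilon> * tan \<psi> / sqrt (K\<^sub>0 * (A\<^sup>2 + B\<^sup>2))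
              * artanh (1 / sqrt (A\<^sup>2 + B\<^sup>2)
                  * (A * tan (1 / 2 * (a * sqrt K\<^sub>0 * t + a\<^sub>0)) - B)) + \<theta>\<^sub>0)))"
    unfolding k_def[symmetric]
    by (intro exI[of _ a] exI[of _ a\<^sub>0] exI[of _ c] exI[of _ \<theta>\<^sub>0] exI[of _ z\<^sub>0] exI[of _ \<epsilon>]
        exI[of _ \<sigma>] conjI ballI)
      (rule a_def a\<^sub>0_def \<epsilon>(1) \<sigma>(1) s gu[unfolded h_def] \<alpha>[unfolded x_def h_def] \<theta>\<^sub>0[unfolded x_def]
        | assumption)+
qed

end
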